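(* For any positive integers $\ell$ and $k\geq 2$, the number of patterns $\alpha\in\mathbb F_2^k$ such that $f_{\alpha}(n)=\Omega(n^{1/(2^\ell -1)})$ is no more than $2^{2^{\ell+1}-1}$. For all other patterns $\alpha\in\mathbb F_2^k$ not satisfying this property, $f_{\alpha}(n)=O(n^{1/2^\ell})$.
   Context: Let $[n]=\{1,\ldots,n\}$ and let $2^{[n]}$ be the collection of all subsets of $[n]$. For $\alpha=(a_1,\ldots,a_k)\in\mathbb F_2^k$, a family $\mathcal F\subset 2^{[n]}$ is an $\alpha$-intersecting family (modulo $2$) if for each $j\in[k]$ and any $j$ distinct members $F_1,\ldots,F_j\in\mathcal F$ one has $|F_1\cap\cdots\cap F_j|\equiv a_j \pmod 2$. Let $f_\alpha(n)$ be the maximum size of an $\alpha$-intersecting family $\mathcal F\subset 2^{[n]}$. Asymptotics are in $n$, with $k,\ell,\alpha$ fixed. For $f,g:\mathbb N\to\mathbb R^+$ (with $\mathbb N=\{1,2,\ldots\}$), $f=O(g)$ means there is a constant $c>0$ with $f(n)\le c\,g(n)$ for all $n\in\mathbb N$, and $f=\Omega(g)$ means $g=O(f)$. *)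

theory Defs
  imports Complex_Main "HOL-Library.FuncSet" "HOL-Library.Z2" "HOL-Library.Landau_Symbols"
begin

(* A pattern (a_1, ..., a_k) over the two-element field is a function on {1..k} with
   alpha j = a_j, made extensional outside {1..k} so that patterns can be counted. *)
definition patterns :: "nat \<Rightarrow> (nat \<Rightarrow> bit) set" where
  "patterns k = {1..k} \<rightarrow>\<^sub>E UNIV"

(* j distinct members are given as a subfamily G of cardinality j. A family with fewer than
   j members satisfies the j-th condition vacuously. *)
definition alpha_intersecting :: "nat \<Rightarrow> (nat \<Rightarrow> bit) \<Rightarrow> nat \<Rightarrow> nat set set \<Rightarrow> bool" where
  "alpha_intersecting k \<alpha> n \<F> \<longleftrightarrow>
     \<F> \<subseteq> Pow {1..n} \<and>
     (\<forall>j\<in>{1..k}. \<forall>\<G>\<subseteq>\<F>. card \<G> = j \<longrightarrow> (of_nat (card (\<Inter>\<G>)) :: bit) = \<alpha> j)"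

definition max_size :: "nat \<Rightarrow> (nat \<Rightarrow> bit) \<Rightarrow> nat \<Rightarrow> nat" where
  "max_size k \<alpha> n = Max {card \<F> | \<F>. alpha_intersecting k \<alpha> n \<F>}"

lemma alpha_intersecting_empty: "alpha_intersecting k \<alpha> n {}"
  by (auto simp: alpha_intersecting_def)

lemma finite_alpha_intersecting: "finite {\<F>. alpha_intersecting k \<alpha> n \<F>}"
  by (rule finite_subset[of _ "Pow (Pow {1..n})"]) (auto simp: alpha_intersecting_def)

(* The maximum is attained: the set of sizes is finite and nonempty. *)
lemma max_size_attained:
  "\<exists>\<F>. alpha_intersecting k \<alpha> n \<F> \<and> card \<F> = max_size k \<alpha> n"
proof -
  have "finite {card \<F> | \<F>. alpha_intersecting k \<alpha> n \<F>}"
    using finite_alpha_intersecting[of k \<alpha> n] by simp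
  moreover have "{card \<F> | \<F>. alpha_intersecting k \<alpha> n \<F>} \<noteq> {}"
    using alpha_intersecting_empty by blast
  ultimately have "max_size k \<alpha> n \<in> {card \<F> | \<F>. alpha_intersecting k \<alpha> n \<F>}"
    unfolding max_size_def by (rule Max_in)
  then show ?thesis by auto
qed

(* Asymptotic bounds are meant to hold for all n \<ge> 1, not just eventually; this is the
   Landau notation with respect to the filter principal {1..}. *)
lemma bigo_all_positive_iff:
  fixes f g :: "nat \<Rightarrow> real"
  assumes "\<And>n. n \<ge> 1 \<Longrightarrow> f n \<ge> 0" "\<And>n. n \<ge> 1 \<Longrightarrow> g n \<ge> 0"
  shows "f \<in> O[principal {1..}](g) \<longleftrightarrow> (\<exists>c>0. \<forall>n\<ge>1. f n \<le> c * g n)"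
  using assms by (auto simp: bigo_def eventually_principal)

lemma bigomega_all_positive_iff:
  fixes f g :: "nat \<Rightarrow> real"
  shows "f \<in> \<Omega>[principal {1..}](g) \<longleftrightarrow> g \<in> O[principal {1..}](f)"
  by (rule bigomega_iff_bigo)

end

theory Submission
  imports Defs
begin

text \<open>
  Put q = 2^l. Both claims follow from a dichotomy: if a_s = a_(s+q) whenever q \<le> s and
  s + q \<le> k, then f is at least of order n^(1/(q-1)), and otherwise f is at most of order
  n^(1/q). There are at most 2^(2q-1) patterns of the first kind, as a_1, ..., a_(2q-1)
  determine them.

  Upper bound. Let a_s \<noteq> a_(s+q), let C consist of s - q members of the family and let A, B
  range over the q-sets of the m remaining members. The parity of the intersection of
  A \<union> B \<union> C is g(i) = a_(s+q-i), where i is the size of A \<inter> B. Expand g on {0, ..., q-1} modulo 2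
  in the binomials C(i, j) with j < q; because C(q, j) is even for 0 < j < q, this expansion
  takes the value g(0) at q, which differs from g(q). So the matrix of the parities plus a
  sum of set-inclusion Gram matrices of order j < q is the identity, and the oddtown theorem
  gives C(m, q) \<le> n + \<Sum>_(j<q) C(m, j).

  Lower bound. Dually, prescribe for every point the set T of indices of the members
  containing it. Taking for T all sets of size below q, with suitable multiplicities, gives
  every pattern supported below q. Their complements give every q-periodic pattern, because
  C(x, j) modulo 2 is q-periodic in x for j < q. This uses O(m^(q-1)) points for m members.
\<close>

text \<open>These simp rules turn sums and products of bits into bit operations, where ring
  normalization no longer applies.\<close>
declare add_bit_eq_xor [simp del] mult_bit_eq_and [simp del]

section \<open>Oddtown and binomial coefficients modulo 2\<close>

lemma of_nat_bit_eq: "(of_nat n :: bit) = of_bool (odd n)"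
  by (induction n) auto

text \<open>Counting replaces linear independence: \<open>\<phi> S\<close> is the symmetric
  difference of the sets \<open>U i\<close> with \<open>i\<close> in \<open>S\<close>. Double
  counting shows that its intersection with \<open>U j\<close> is odd exactly when \<open>j\<close>
  lies in \<open>S\<close>, so \<open>\<phi>\<close> is injective on the subsets of
  \<open>I\<close>.\<close>

lemma oddtown:
  assumes "finite I" "finite X"
    and sub: "\<And>i. i \<in> I \<Longrightarrow> U i \<subseteq> X"
    and odd: "\<And>i j. i \<in> I \<Longrightarrow> j \<in> I \<Longrightarrow> odd (card (U i \<inter> U j)) \<longleftrightarrow> i = j"
  shows "card I \<le> card X"
proof -
  define \<phi> where "\<phi> S = {x \<in> X. odd (card {i \<in> S. x \<in> U i})}" for S
  have detect: "odd (card (\<phi> S \<inter> U j)) \<longleftrightarrow> j \<in> S" if S: "S \<subseteq> I" and j: "j \<in> I" for S j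
  proof -
    have fin: "finite S" "finite (U j)"
      using S j sub assms(1,2) by (auto intro: finite_subset)
    have "\<phi> S \<inter> U j = {x \<in> U j. odd (card {i \<in> S. x \<in> U i})}"
      using sub[OF j] by (auto simp: \<phi>_def)
    then have "odd (card (\<phi> S \<inter> U j)) \<longleftrightarrow> odd (\<Sum>x\<in>U j. card {i \<in> S. x \<in> U i})"
      using fin by (simp add: even_sum_iff)
    also have "(\<Sum>x\<in>U j. card {i \<in> S. x \<in> U i}) = (\<Sum>i\<in>S. card {x \<in> U j. x \<in> U i})"
      using fin by (intro sum_multicount_gen) auto
    also have "odd \<dots> \<longleftrightarrow> odd (card {i \<in> S. odd (card {x \<in> U j. x \<in> U i})})"
      using fin by (simp add: even_sum_iff)
    also have "{i \<in> S. odd (card {x \<in> U j. x \<in> U i})} = S \<inter> {j}"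
    proof -
      have "{x \<in> U j. x \<in> U i} = U i \<inter> U j" for i by auto
      then show ?thesis using odd S j by auto
    qed
    finally show ?thesis by (cases "j \<in> S") auto
  qed
  have "inj_on \<phi> (Pow I)"
  proof (rule inj_onI)
    fix S T assume "S \<in> Pow I" "T \<in> Pow I" "\<phi> S = \<phi> T"
    then show "S = T" using detect[of S] detect[of T] by auto
  qed
  moreover have "\<phi> ` Pow I \<subseteq> Pow X" by (auto simp: \<phi>_def)
  ultimately have "card (Pow I) \<le> card (Pow X)"
    using assms(2) by (intro card_inj_on_le) auto
  then show ?thesis using assms(1,2) by (simp add: card_Pow)
qed

text \<open>The system is triangular with unit diagonal: \<open>i choose q\<close> is 0 for
  \<open>i < q\<close> and 1 for \<open>i = q\<close>, so each new coefficient is the residual at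
  \<open>q\<close> and leaves earlier values unchanged.\<close>

lemma newton_expansion_bit:
  fixes g :: "nat \<Rightarrow> bit"
  shows "\<exists>c. \<forall>i<q. g i = (\<Sum>j<q. of_nat (i choose j) * c j)"
proof (induction q)
  case (Suc q)
  then obtain c where c: "\<And>i. i < q \<Longrightarrow> g i = (\<Sum>j<q. of_nat (i choose j) * c j)" by blast
  let ?c = "c(q := g q - (\<Sum>j<q. of_nat (q choose j) * c j))"
  have "g i = (\<Sum>j<Suc q. of_nat (i choose j) * ?c j)" if "i < Suc q" for i
    using that c[of i] by (cases "i = q") (auto simp: less_Suc_eq binomial_eq_0)
  then show ?case by blast
qed auto

text \<open>By absorption, 2^l divides \<open>j\<close> times the binomial; an odd binomial would
  force 2^l to divide \<open>j\<close>.\<close>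

lemma even_choose_two_power:
  assumes "0 < j" "j < 2 ^ l"
  shows "even ((2 ^ l :: nat) choose j)"
proof (rule ccontr)
  assume "odd ((2 ^ l :: nat) choose j)"
  then have "coprime (2 ^ l) ((2 ^ l :: nat) choose j)" by simp
  moreover have "j * ((2 ^ l :: nat) choose j) = 2 ^ l * ((2 ^ l - 1) choose (j - 1))"
    using assms times_binomial_minus1_eq by blast
  then have "2 ^ l dvd j * ((2 ^ l :: nat) choose j)" by simp
  ultimately have "2 ^ l dvd j" using coprime_dvd_mult_left_iff by blast
  then show False using assms by (auto dest: dvd_imp_le)
qed

text \<open>In Vandermonde's sum every term except \<open>i = 0\<close> has an even factor.\<close>

lemma choose_add_two_power_bit:
  assumes "t < 2 ^ l"
  shows "(of_nat ((2 ^ l + x) choose t) :: bit) = of_nat (x choose t)"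
proof -
  have "((2 ^ l + x) choose t) = (\<Sum>i\<le>t. ((2 ^ l) choose i) * (x choose (t - i)))"
    by (simp add: vandermonde)
  also have "\<dots> = (x choose t) + (\<Sum>i\<in>{..t}-{0}. ((2 ^ l) choose i) * (x choose (t - i)))"
    by (subst sum.remove[of _ 0]) auto
  finally have "((2 ^ l + x) choose t) = (x choose t) + (\<Sum>i\<in>{..t}-{0}. ((2 ^ l) choose i) * (x choose (t - i)))" .
  moreover have "even (\<Sum>i\<in>{..t}-{0}. ((2 ^ l) choose i) * (x choose (t - i)) :: nat)"
    using assms by (intro dvd_sum) (auto intro!: dvd_mult2 even_choose_two_power)
  ultimately show ?thesis by (simp add: of_nat_bit_eq)
qed

text \<open>An expansion valid on the first period extends to all arguments, because both sides have
  period 2^l.\<close>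

lemma newton_expansion_periodic_bit:
  fixes g :: "nat \<Rightarrow> bit"
  assumes "\<And>i. g (2 ^ l + i) = g i"
  shows "\<exists>c. \<forall>i. g i = (\<Sum>j<2 ^ l. of_nat (i choose j) * c j)"
proof -
  obtain c where c: "\<And>i. i < 2 ^ l \<Longrightarrow> g i = (\<Sum>j<2 ^ l. of_nat (i choose j) * c j)"
    using newton_expansion_bit[of "2 ^ l" g] by blast
  have "g i = (\<Sum>j<2 ^ l. of_nat (i choose j) * c j)" for i
  proof (induction i rule: less_induct)
    case (less i)
    show ?case
    proof (cases "i < 2 ^ l")
      case False
      then obtain x where x: "i = 2 ^ l + x" using le_Suc_ex not_less by blast
      have "g x = (\<Sum>j<2 ^ l. of_nat (x choose j) * c j)" using x by (intro less) simp
      then show ?thesis using assms[of x] by (simp add: x choose_add_two_power_bit)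
    qed (rule c)
  qed
  then show ?thesis by blast
qed

section \<open>Upper bound for patterns that violate periodicity\<close>

text \<open>Oddtown is applied to the q-sets of members outside \<open>C\<close>, over a ground set
  made of the n points and of all sets of fewer than q such members; the latter account for the sum
  on the right.\<close>

lemma intersecting_binomial_bound:
  assumes \<F>: "alpha_intersecting k \<alpha> n \<F>"
    and s: "2 ^ l \<le> s" "s + 2 ^ l \<le> k" "\<alpha> s \<noteq> \<alpha> (s + 2 ^ l)"
    and m: "card \<F> = (s - 2 ^ l) + m"
  shows "m choose (2 ^ l) \<le> n + (\<Sum>j<2 ^ l. m choose j)"
proof -
  define q :: nat where "q = 2 ^ l"
  have q: "0 < q" by (simp add: q_def)
  have fin: "finite \<F>" using \<F> by (auto simp: alpha_intersecting_def intro: finite_subset)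
  \<comment> \<open>With \<open>s - q\<close> fixed members, the union of \<open>A\<close>,
    \<open>B\<close> and \<open>C\<close> has between \<open>s\<close> members (if
    \<open>A = B\<close>) and \<open>s + q\<close> members (if \<open>A\<close> and \<open>B\<close>
    are disjoint).\<close>
  obtain C where C: "C \<subseteq> \<F>" "card C = s - q"
    using m by (metis obtain_subset_with_card_n le_add1 q_def)
  have finC: "finite C" using C fin finite_subset by blast
  define M where "M = \<F> - C"
  have M: "finite M" "card M = m" using C fin m finC by (auto simp: M_def card_Diff_subset q_def)
  obtain c where c: "\<And>i. i < q \<Longrightarrow> \<alpha> (s + q - i) = (\<Sum>j<q. of_nat (i choose j) * c j)"
    using newton_expansion_bit[of q "\<lambda>i. \<alpha> (s + q - i)"] by blast
  have top: "\<alpha> s \<noteq> (\<Sum>j<q. of_nat (q choose j) * c j)"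
  proof -
    have "(\<Sum>j<q. of_nat (q choose j) * c j) = c 0 + (\<Sum>j\<in>{..<q}-{0}. of_nat (q choose j) * c j)"
      using q by (subst sum.remove[of _ 0]) auto
    also have "(\<Sum>j\<in>{..<q}-{0}. of_nat (q choose j) * c j) = 0"
      by (intro sum.neutral) (auto simp: of_nat_bit_eq q_def even_choose_two_power)
    also have "c 0 = \<alpha> (s + q)"
    proof -
      have "\<alpha> (s + q) = (\<Sum>j<q. of_nat (0 choose j) * c j)" using c[of 0] q by simp
      also have "\<dots> = c 0 + (\<Sum>j\<in>{..<q}-{0}. of_nat (0 choose j) * c j)"
        using q by (subst sum.remove[of _ 0]) auto
      also have "(\<Sum>j\<in>{..<q}-{0}. of_nat (0 choose j) * c j) = 0"
        by (intro sum.neutral) (auto simp: binomial_eq_0)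
      finally show ?thesis by simp
    qed
    finally show ?thesis using s(3) by (simp add: q_def)
  qed
  define I where "I = {A. A \<subseteq> M \<and> card A = q}"
  define L where "L = {J. J \<subseteq> M \<and> card J < q}"
  \<comment> \<open>The left summand contributes the true intersection sizes. The right summand
    contributes the Gram matrices: the small sets \<open>J\<close> common to \<open>A\<close> and
    \<open>B\<close> number \<open>i choose j\<close> for each size \<open>j\<close> with
    \<open>c j = 1\<close>.\<close>
  define U where "U A = Inl ` \<Inter>(A \<union> C) \<union> Inr ` {J. J \<subseteq> A \<and> card J < q \<and> c (card J) = 1}"
    for A
  have I: "finite I" "card I = m choose q"
    using M n_subsets[OF M(1), of q] by (auto simp: I_def)
  have cL: "finite L" "card L = (\<Sum>j<q. m choose j)"
  proof -
    have "L = (\<Union>j<q. {J. J \<subseteq> M \<and> card J = j})" by (auto simp: L_def)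
    also have "card \<dots> = (\<Sum>j<q. card {J. J \<subseteq> M \<and> card J = j})"
      using M by (intro card_UN_disjoint) auto
    finally show "card L = (\<Sum>j<q. m choose j)" using M n_subsets[OF M(1)] by simp
    show "finite L" using M by (auto simp: L_def)
  qed
  have "card I \<le> card ({1..n} <+> L)"
  proof (rule oddtown[where U = U])
    fix A assume A: "A \<in> I"
    have "A \<noteq> {}" using A q by (auto simp: I_def)
    then obtain F where "F \<in> A" by blast
    moreover have "A \<subseteq> Pow {1..n}" using A \<F> by (auto simp: I_def M_def alpha_intersecting_def)
    ultimately have "\<Inter>(A \<union> C) \<subseteq> {1..n}" by blast
    then show "U A \<subseteq> {1..n} <+> L" using A by (fastforce simp: U_def L_def I_def)
  next
    fix A B assume A: "A \<in> I" and B: "B \<in> I"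
    have fAB: "finite A" "finite B" "finite (A \<inter> B)" "card A = q" "card B = q" "A \<noteq> {}"
      using A B M q by (auto simp: I_def intro: finite_subset)
    define i where "i = card (A \<inter> B)"
    have i: "i \<le> q" using fAB by (metis i_def card_mono inf_le1)
    have iq: "i = q \<longleftrightarrow> A = B"
      using fAB by (metis i_def card_subset_eq inf.idem inf_le1 inf_le2)
    have UU: "U A \<inter> U B = Inl ` \<Inter>(A \<union> B \<union> C) \<union> Inr ` {J. J \<subseteq> A \<inter> B \<and> card J < q \<and> c (card J) = 1}"
      by (auto simp: U_def)
    have "finite (\<Inter>(A \<union> B \<union> C))"
    proof -
      obtain F where F: "F \<in> A" using fAB by blast
      then have "F \<subseteq> {1..n}" using A \<F> by (auto simp: I_def M_def alpha_intersecting_def)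
      then have "finite F" by (rule finite_subset) simp
      then show ?thesis using F by (auto intro: finite_subset[of _ F])
    qed
    then have "card (U A \<inter> U B) = card (\<Inter>(A \<union> B \<union> C)) + card {J. J \<subseteq> A \<inter> B \<and> card J < q \<and> c (card J) = 1}"
      unfolding UU using fAB by (subst card_Un_disjoint) (auto simp: card_image)
    moreover have "(of_nat (card (\<Inter>(A \<union> B \<union> C))) :: bit) = \<alpha> (s + q - i)"
    proof -
      have "card (A \<union> B) + i = q + q" using card_Un_Int[of A B] fAB by (simp add: i_def)
      moreover have "card (A \<union> B \<union> C) = card (A \<union> B) + (s - q)"
        using A B C fAB finC by (subst card_Un_disjoint) (auto simp: I_def M_def)
      ultimately have "card (A \<union> B \<union> C) = s + q - i" using s i by (simp add: q_def)
      moreover have "A \<union> B \<union> C \<subseteq> \<F>" using A B C by (auto simp: I_def M_def)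
      moreover have "s + q - i \<in> {1..k}" using s(1,2) i q unfolding q_def[symmetric] by auto
      ultimately show ?thesis using \<F> unfolding alpha_intersecting_def by metis
    qed
    moreover have "(of_nat (card {J. J \<subseteq> A \<inter> B \<and> card J < q \<and> c (card J) = 1}) :: bit)
        = (\<Sum>j<q. of_nat (i choose j) * c j)"
    proof -
      have "{J. J \<subseteq> A \<inter> B \<and> card J < q \<and> c (card J) = 1}
          = (\<Union>j\<in>{j\<in>{..<q}. c j = 1}. {J. J \<subseteq> A \<inter> B \<and> card J = j})" by auto
      also have "card \<dots> = (\<Sum>j\<in>{j\<in>{..<q}. c j = 1}. card {J. J \<subseteq> A \<inter> B \<and> card J = j})"
        using fAB by (intro card_UN_disjoint) auto
      also have "\<dots> = (\<Sum>j\<in>{j\<in>{..<q}. c j = 1}. i choose j)"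
        using n_subsets[OF fAB(3)] by (simp add: i_def)
      also have "(of_nat \<dots> :: bit) = (\<Sum>j<q. of_nat (i choose j) * c j)"
        unfolding of_nat_sum by (intro sum.mono_neutral_cong_left) auto
      finally show ?thesis .
    qed
    ultimately have "(of_nat (card (U A \<inter> U B)) :: bit)
        = \<alpha> (s + q - i) + (\<Sum>j<q. of_nat (i choose j) * c j)" by simp
    \<comment> \<open>For \<open>i < q\<close> the two terms are equal and cancel; at
      \<open>i = q\<close> they are different bits by \<open>top\<close>.\<close>
    also have "\<dots> = of_bool (i = q)"
      using c[of i] top i by (cases "i = q"; cases "\<alpha> s"; cases "\<Sum>j<q. of_nat (q choose j) * c j") auto
    finally show "odd (card (U A \<inter> U B)) \<longleftrightarrow> A = B"
      unfolding of_nat_bit_eq iq by (simp split: split_of_bool_asm)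
  qed (use I cL in auto)
  also have "\<dots> = n + card L" using cL by (simp add: card_Plus)
  finally show ?thesis using I cL by (simp add: q_def)
qed


lemma sum_choose_le:
  assumes "1 \<le> m" "1 \<le> q"
  shows "(\<Sum>j<q. m choose j) \<le> q * m ^ (q - 1)"
proof -
  have "m choose j \<le> m ^ (q - 1)" if "j < q" for j
  proof (cases "j \<le> m")
    case True
    then have "m choose j \<le> m ^ j" by (rule binomial_le_pow)
    also have "\<dots> \<le> m ^ (q - 1)" using that assms by (intro power_increasing) auto
    finally show ?thesis .
  qed (simp add: binomial_eq_0)
  then have "(\<Sum>j<q. m choose j) \<le> (\<Sum>j<q. m ^ (q - 1))" by (intro sum_mono) auto
  then show ?thesis by simp
qed

text \<open>The binomial bound gives m^q \<le> q^q n + q^(q+1) m^(q-1). Once m \<ge> 2 q^(q+1), the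
  last term is at most half of m^q and can be absorbed. Smaller families are covered by the
  constant, since n^(1/q) \<ge> 1; the summand \<open>k\<close> pays for the \<open>s - q\<close>
  fixed members.\<close>

lemma max_size_aperiodic_le:
  fixes q :: nat
  assumes q: "q = 2 ^ l"
    and s: "q \<le> s" "s + q \<le> k" "\<alpha> s \<noteq> \<alpha> (s + q)"
    and n: "1 \<le> n"
  shows "real (max_size k \<alpha> n) \<le> real (k + 2 * q ^ (q + 1) + 2 * q) * real n powr (1 / q)"
proof -
  define N where "N = max_size k \<alpha> n"
  define r where "r = real n powr (1 / q)"
  have q1: "1 \<le> q" by (simp add: q)
  have r1: "1 \<le> r" using n by (simp add: r_def ge_one_powr_ge_zero)
  have rq: "r ^ q = real n" using n q1 by (simp add: r_def powr_realpow' powr_power)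
  have "real N \<le> real (k + 2 * q ^ (q + 1)) + real (2 * q) * r"
  proof (cases "N \<le> k + 2 * q ^ (q + 1)")
    case True
    then have "real N \<le> real (k + 2 * q ^ (q + 1))" by (rule of_nat_mono)
    then show ?thesis using r1 by (intro add_increasing2) auto
  next
    case False
    define m where "m = N - (s - q)"
    have N: "N = (s - q) + m" "N \<le> k + m" using False s by (auto simp: m_def)
    have mbig: "2 * q ^ (q + 1) \<le> m" using False s by (auto simp: m_def)
    have "q \<le> q ^ (q + 1)" using q1 by (intro self_le_power) auto
    then have m: "q \<le> m" "1 \<le> m" using mbig q1 by linarith+
    obtain \<F> where "alpha_intersecting k \<alpha> n \<F>" "card \<F> = N"
      using max_size_attained N_def by metis
    then have "m choose q \<le> n + (\<Sum>j<q. m choose j)"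
      using intersecting_binomial_bound[of k \<alpha> n \<F> l s m] s N by (simp add: q)
    also have "\<dots> \<le> n + q * m ^ (q - 1)" using sum_choose_le[OF m(2) q1] by simp
    finally have "real (m choose q) \<le> real n + real q * real m ^ (q - 1)"
      by (metis of_nat_add of_nat_le_iff of_nat_mult of_nat_power)
    then have "(real m / real q) ^ q \<le> real n + real q * real m ^ (q - 1)"
      using binomial_ge_n_over_k_pow_k[OF m(1), where 'a = real] by linarith
    then have "real m ^ q \<le> real q ^ q * (real n + real q * real m ^ (q - 1))"
      using q1 by (simp add: power_divide divide_le_eq mult.commute)
    then have 1: "real m ^ q \<le> real q ^ q * real n + real q ^ (q + 1) * real m ^ (q - 1)"
      by (simp add: algebra_simps)
    have "2 * real q ^ (q + 1) \<le> real m" using mbig by (metis of_nat_le_iff of_nat_mult of_nat_numeral of_nat_power)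
    then have "2 * real q ^ (q + 1) * real m ^ (q - 1) \<le> real m * real m ^ (q - 1)"
      by (intro mult_right_mono) auto
    also have "\<dots> = real m ^ q" using q1 by (metis power_eq_if not_one_le_zero)
    finally have "real m ^ q \<le> 2 * real q ^ q * real n" using 1 by linarith
    \<comment> \<open>The factor 2 is weakened to 2^q to obtain a perfect q-th power.\<close>
    also have "\<dots> \<le> 2 ^ q * real q ^ q * real n"
      using q1 self_le_power[of "2::real" q] by (intro mult_right_mono) auto
    also have "\<dots> = (real (2 * q) * r) ^ q" by (simp add: power_mult_distrib rq)
    finally have "real m \<le> real (2 * q) * r"
      by (subst (asm) power_mono_iff) (use r1 q1 in auto)
    moreover have "real N \<le> real k + real m" using N(2) by linarith
    moreover have "0 \<le> real (2 * q ^ (q + 1))" by (rule of_nat_0_le_iff)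
    ultimately show ?thesis unfolding of_nat_add by linarith
  qed
  also have "\<dots> \<le> real (k + 2 * q ^ (q + 1)) * r + real (2 * q) * r"
    using r1 by (intro add_right_mono) (metis mult.right_neutral mult_left_mono of_nat_0_le_iff)
  finally show ?thesis by (simp add: N_def r_def algebra_simps)
qed

section \<open>Lower bound: patterns realized by lists of index sets\<close>

text \<open>The list \<open>Ts\<close> gives for each point the indices of the members containing it, so that
  the points of the intersection of the members indexed by \<open>S\<close> are those with \<open>S \<subseteq> T\<close>.\<close>
definition realizes :: "nat \<Rightarrow> nat set list \<Rightarrow> (nat \<Rightarrow> bit) \<Rightarrow> bool" where
  "realizes m Ts \<beta> \<longleftrightarrow>
     (\<forall>S\<subseteq>{..<m}. S \<noteq> {} \<longrightarrow> (of_nat (length (filter ((\<subseteq>) S) Ts)) :: bit) = \<beta> (card S))"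

lemma realizes_append:
  "realizes m Ts \<beta> \<Longrightarrow> realizes m Us \<gamma> \<Longrightarrow> realizes m (Ts @ Us) (\<lambda>s. \<beta> s + \<gamma> s)"
  by (auto simp: realizes_def)

lemma realizes_cong:
  assumes "realizes m Ts \<beta>" and "\<And>s. 1 \<le> s \<Longrightarrow> s \<le> m \<Longrightarrow> \<beta> s = \<gamma> s"
  shows "realizes m Ts \<gamma>"
proof -
  have "\<beta> (card S) = \<gamma> (card S)" if "S \<subseteq> {..<m}" "S \<noteq> {}" for S
  proof (rule assms(2))
    show "card S \<le> m" using card_mono[OF _ that(1)] by simp
    show "1 \<le> card S" using that by (simp add: Suc_le_eq card_gt_0_iff finite_subset)
  qed
  then show ?thesis using assms(1) by (auto simp: realizes_def)
qed

lemma card_supersets: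
  assumes "finite V" "S \<subseteq> V" "card S \<le> t"
  shows "card {T. T \<subseteq> V \<and> card T = t \<and> S \<subseteq> T} = (card V - card S) choose (t - card S)"
proof -
  have fin: "finite S" using assms finite_subset by blast
  have "bij_betw (\<lambda>U. U \<union> S) {U. U \<subseteq> V - S \<and> card U = t - card S}
          {T. T \<subseteq> V \<and> card T = t \<and> S \<subseteq> T}"
  proof (rule bij_betwI[where g = "\<lambda>T. T - S"])
    show "(\<lambda>U. U \<union> S) \<in> {U. U \<subseteq> V - S \<and> card U = t - card S} \<rightarrow> {T. T \<subseteq> V \<and> card T = t \<and> S \<subseteq> T}"
    proof safe
      fix U assume U: "U \<subseteq> V - S" "card U = t - card S"
      then have "card (U \<union> S) = card U + card S"
        using fin assms by (intro card_Un_disjoint) (auto intro: finite_subset)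
      then show "card (U \<union> S) = t" using U assms by simp
    qed (use assms in auto)
  qed (use fin in \<open>auto simp: card_Diff_subset\<close>)
  then have "card {T. T \<subseteq> V \<and> card T = t \<and> S \<subseteq> T} = card {U. U \<subseteq> V - S \<and> card U = t - card S}"
    by (simp add: bij_betw_same_card)
  also have "\<dots> = card (V - S) choose (t - card S)" using assms by (simp add: n_subsets)
  finally show ?thesis using assms fin by (simp add: card_Diff_subset)
qed

text \<open>Every t-set of indices is used for exactly one point.\<close>

lemma realizes_layer:
  "\<exists>Ts. realizes m Ts (\<lambda>s. if s \<le> t then of_nat ((m - s) choose (t - s)) else 0)
     \<and> length Ts = m choose t"
proof -
  define L where "L = {T. T \<subseteq> {..<m} \<and> card T = t}"
  have "finite L" by (simp add: L_def)
  then obtain Ts where Ts: "set Ts = L" "distinct Ts" using finite_distinct_list by blast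
  have "length (filter ((\<subseteq>) S) Ts) = (if card S \<le> t then (m - card S) choose (t - card S) else 0)"
    if S: "S \<subseteq> {..<m}" for S
  proof -
    have eq: "length (filter ((\<subseteq>) S) Ts) = card {T. T \<subseteq> {..<m} \<and> card T = t \<and> S \<subseteq> T}"
      using Ts by (simp add: distinct_length_filter) (rule arg_cong[of _ _ card], auto simp: L_def)
    show ?thesis
    proof (cases "card S \<le> t")
      case False
      then have "{T. T \<subseteq> {..<m} \<and> card T = t \<and> S \<subseteq> T} = {}"
        by (auto dest: card_mono[rotated] intro: finite_subset)
      then show ?thesis using False by (simp add: eq)
    qed (use S eq card_supersets[of "{..<m}" S t] in simp)
  qed
  moreover have "length Ts = m choose t"
    using Ts distinct_card[of Ts] n_subsets[of "{..<m}" t] by (simp add: L_def)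
  ultimately show ?thesis unfolding realizes_def by (intro exI[of _ Ts]) auto
qed

text \<open>The support is cleared from the top: the layer of t-sets has value 1 at size
  \<open>t\<close> and 0 above it, so adding it removes a nonzero \<open>\<beta> t\<close> and
  changes only smaller sizes.\<close>

lemma realizes_bounded_support:
  assumes "\<And>s. t \<le> s \<Longrightarrow> \<beta> s = 0"
  shows "\<exists>Ts. realizes m Ts \<beta> \<and> length Ts \<le> (\<Sum>j<t. m choose j)"
  using assms
proof (induction t arbitrary: \<beta>)
  case 0
  then show ?case by (intro exI[of _ "[]"]) (auto simp: realizes_def)
next
  case (Suc t)
  show ?case
  proof (cases "\<beta> t = 0")
    case True
    then have "\<beta> s = 0" if "t \<le> s" for s using Suc.prems that by (cases "s = t") auto
    then obtain Ts where "realizes m Ts \<beta>" "length Ts \<le> (\<Sum>j<t. m choose j)"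
      using Suc.IH by blast
    then show ?thesis by (intro exI[of _ Ts]) auto
  next
    case False
    define \<delta> :: "nat \<Rightarrow> bit" where "\<delta> s = (if s \<le> t then of_nat ((m - s) choose (t - s)) else 0)" for s
    obtain Us where Us: "realizes m Us \<delta>" "length Us = m choose t"
      using realizes_layer[of m t] unfolding \<delta>_def by blast
    have "\<beta> s + \<delta> s = 0" if "t \<le> s" for s
      using Suc.prems[of s] that False by (cases "s = t") (auto simp: \<delta>_def)
    then obtain Ts where Ts: "realizes m Ts (\<lambda>s. \<beta> s + \<delta> s)" "length Ts \<le> (\<Sum>j<t. m choose j)"
      using Suc.IH[of "\<lambda>s. \<beta> s + \<delta> s"] by blast
    have "realizes m (Ts @ Us) \<beta>"
      using realizes_append[OF Ts(1) Us(1)] by (rule realizes_cong) (simp add: add.assoc)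
    then show ?thesis using Ts Us by (intro exI[of _ "Ts @ Us"]) auto
  qed
qed

text \<open>Complements of t-sets form the layer of size \<open>m - t\<close>, whose value at
  \<open>s\<close> is \<open>(m - s) choose (m - t - s)\<close>, that is
  \<open>(m - s) choose t\<close> by symmetry.\<close>

lemma realizes_newton:
  "\<exists>Ts. realizes m Ts (\<lambda>s. \<Sum>j<t. of_nat ((m - s) choose j) * c j)
     \<and> length Ts \<le> (\<Sum>j<t. m choose j)"
proof (induction t)
  case 0
  then show ?case by (intro exI[of _ "[]"]) (auto simp: realizes_def)
next
  case (Suc t)
  then obtain Ts where Ts: "realizes m Ts (\<lambda>s. \<Sum>j<t. of_nat ((m - s) choose j) * c j)"
    "length Ts \<le> (\<Sum>j<t. m choose j)" by blast
  show ?case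
  \<comment> \<open>For \<open>m < t\<close> the binomial vanishes and no points are added;
    truncated subtraction would turn \<open>m - t\<close> into 0 and give a wrong layer.\<close>
  proof (cases "c t = 0 \<or> m < t")
    case True
    then have "of_nat ((m - s) choose t) * c t = 0" for s by (auto simp: binomial_eq_0)
    then have "(\<lambda>s. \<Sum>j<Suc t. of_nat ((m - s) choose j) * c j) = (\<lambda>s. \<Sum>j<t. of_nat ((m - s) choose j) * c j)"
      by (simp only: sum.lessThan_Suc add_0_right)
    then show ?thesis using Ts by (intro exI[of _ Ts]) simp
  next
    case False
    obtain Us where Us: "realizes m Us (\<lambda>s. if s \<le> m - t then of_nat ((m - s) choose (m - t - s)) else 0)"
      "length Us = m choose (m - t)" using realizes_layer[of m "m - t"] by blast
    have "realizes m Us (\<lambda>s. of_nat ((m - s) choose t) * c t)"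
    proof (rule realizes_cong[OF Us(1)])
      fix s assume "s \<le> m"
      show "(if s \<le> m - t then of_nat ((m - s) choose (m - t - s)) else 0) = of_nat ((m - s) choose t) * c t"
        using False \<open>s \<le> m\<close> binomial_symmetric[of t "m - s"]
        by (cases "t \<le> m - s") (auto simp: binomial_eq_0 diff_diff_eq add.commute)
    qed
    then have "realizes m (Ts @ Us) (\<lambda>s. \<Sum>j<Suc t. of_nat ((m - s) choose j) * c j)"
      using realizes_append[OF Ts(1)] by simp
    then show ?thesis using Ts Us False binomial_symmetric[of t m]
      by (intro exI[of _ "Ts @ Us"]) auto
  qed
qed

text \<open>Rewritten as a function of \<open>m - s\<close>, a periodic pattern is still periodic,
  hence a combination of the binomials in \<open>m - s\<close> of order below 2^l.\<close>

lemma realizes_periodic: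
  assumes "\<And>s. \<beta> (s + 2 ^ l) = \<beta> s"
  shows "\<exists>Ts. realizes m Ts \<beta> \<and> length Ts \<le> (\<Sum>j<2 ^ l. m choose j)"
proof -
  have mult: "\<beta> (s + x * 2 ^ l) = \<beta> s" for s x
  proof (induction x)
    case (Suc x)
    then show ?case using assms[of "s + x * 2 ^ l"] by (simp add: algebra_simps)
  qed simp
  \<comment> \<open>\<open>e\<close> is 2^l - 1, so multiplication by \<open>e\<close> acts as
    negation modulo the period.\<close>
  obtain e where e: "(2 ^ l :: nat) = Suc e" using not0_implies_Suc[of "2 ^ l"] by auto
  \<comment> \<open>Modulo \<open>2 ^ l\<close> the argument is \<open>m - y\<close>, so \<open>g (m - s) = \<beta> s\<close> without truncated subtraction.\<close>
  define g where "g y = \<beta> (m + e * y)" for y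
  have "g (2 ^ l + y) = g y" for y
    using mult[of "m + e * y" e] by (simp add: g_def e algebra_simps)
  then obtain c where c: "\<And>y. g y = (\<Sum>j<2 ^ l. of_nat (y choose j) * c j)"
    using newton_expansion_periodic_bit[of g l] by blast
  obtain Ts where Ts: "realizes m Ts (\<lambda>s. \<Sum>j<2 ^ l. of_nat ((m - s) choose j) * c j)"
    "length Ts \<le> (\<Sum>j<2 ^ l. m choose j)" using realizes_newton by blast
  have "realizes m Ts \<beta>"
  proof (rule realizes_cong[OF Ts(1)])
    fix s assume s: "s \<le> m"
    then have "m + e * (m - s) = s + (m - s) * 2 ^ l" by (simp add: e)
    then show "(\<Sum>j<2 ^ l. of_nat ((m - s) choose j) * c j) = \<beta> s"
      using mult by (simp flip: c add: g_def)
  qed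
  then show ?thesis using Ts by blast
qed

section \<open>From realizations to families of sets\<close>

lemma card_le_max_size: "alpha_intersecting k \<alpha> n \<F> \<Longrightarrow> card \<F> \<le> max_size k \<alpha> n"
  unfolding max_size_def using finite_alpha_intersecting[of k \<alpha> n] by (intro Max_ge) auto

lemma max_size_pos:
  assumes "1 \<le> n"
  shows "1 \<le> max_size k \<alpha> n"
proof -
  \<comment> \<open>A one-member family is constrained only at \<open>j = 1\<close>, so a set of the
    right parity suffices.\<close>
  define F :: "nat set" where "F = (if \<alpha> 1 = 1 then {1} else {})"
  have "alpha_intersecting k \<alpha> n {F}"
    using assms by (auto simp: alpha_intersecting_def F_def subset_singleton_iff)
  then show ?thesis using card_le_max_size by fastforce
qed

text \<open>Position \<open>p\<close> of the list becomes the point \<open>Suc p\<close>, and member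
  \<open>i\<close> collects the points whose index set contains \<open>i\<close>; any further points
  up to \<open>n\<close> lie in no member.\<close>

lemma realizes_le_max_size:
  assumes Ts: "realizes m Ts \<beta>" and n: "length Ts + 2 * m \<le> n"
    and \<beta>: "\<And>s. 1 \<le> s \<Longrightarrow> s \<le> k \<Longrightarrow> \<beta> s = \<alpha> s"
  shows "m \<le> max_size k \<alpha> n"
proof -
  define Vs where "Vs = map (\<lambda>i::nat. {i}) [0..<m]"
  \<comment> \<open>Doubled singletons leave all parities unchanged and make the members distinct.\<close>
  define Us where "Us = Ts @ Vs @ Vs"
  define F where "F i = Suc ` {p. p < length Us \<and> i \<in> Us ! p}" for i
  have "realizes m (Vs @ Vs) (\<lambda>_. 0)"
    by (auto simp: realizes_def)
  from realizes_append[OF Ts this] have Us: "realizes m Us \<beta>" by (simp add: Us_def)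
  have len: "length Us \<le> n" using n by (simp add: Us_def Vs_def)
  have inj: "inj_on F {..<m}"
  proof (rule inj_onI)
    fix i j assume ij: "i \<in> {..<m}" "j \<in> {..<m}" "F i = F j"
    have "Us ! (length Ts + i) = {i}" "length Ts + i < length Us"
      using ij by (auto simp: Us_def Vs_def nth_append)
    then have "Suc (length Ts + i) \<in> F i" by (auto simp: F_def)
    then have "j \<in> Us ! (length Ts + i)" unfolding ij(3) by (auto simp: F_def)
    then show "i = j" using \<open>Us ! _ = {i}\<close> by simp
  qed
  have "alpha_intersecting k \<alpha> n (F ` {..<m})"
    unfolding alpha_intersecting_def
  proof (intro conjI ballI allI impI)
    show "F ` {..<m} \<subseteq> Pow {1..n}" using len by (auto simp: F_def)
  next
    fix j \<G> assume j: "j \<in> {1..k}" and \<G>: "\<G> \<subseteq> F ` {..<m}" "card \<G> = j"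
    obtain S where S: "S \<subseteq> {..<m}" "\<G> = F ` S" using \<G> by (auto simp: subset_image_iff)
    have cS: "card S = j" using \<G> S inj by (metis card_image inj_on_subset)
    then have "S \<noteq> {}" using j by auto
    have "\<Inter>\<G> = Suc ` {p. p < length Us \<and> S \<subseteq> Us ! p}"
      using \<open>S \<noteq> {}\<close> by (auto simp: S F_def)
    then have "card (\<Inter>\<G>) = length (filter ((\<subseteq>) S) Us)"
      by (simp add: card_image length_filter_conv_card)
    then show "of_nat (card (\<Inter>\<G>)) = \<alpha> j"
      using Us S \<open>S \<noteq> {}\<close> cS \<beta>[of j] j by (simp add: realizes_def)
  qed
  then show ?thesis using card_le_max_size inj by (fastforce simp: card_image)
qed

section \<open>Eventually periodic patterns and their number\<close>

text \<open>The condition starts at \<open>q\<close> because values at smaller sizes can be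
  corrected freely by patterns supported below \<open>q\<close>.\<close>

definition eventually_periodic :: "nat \<Rightarrow> nat \<Rightarrow> (nat \<Rightarrow> bit) \<Rightarrow> bool" where
  "eventually_periodic k q \<alpha> \<longleftrightarrow> (\<forall>s. q \<le> s \<longrightarrow> s + q \<le> k \<longrightarrow> \<alpha> s = \<alpha> (s + q))"

lemma eventually_periodic_mod:
  assumes "eventually_periodic k q \<alpha>" "0 < q" "q \<le> s" "s \<le> k"
  shows "\<alpha> s = \<alpha> (q + s mod q)"
  using assms(3,4)
proof (induction s rule: less_induct)
  case (less s)
  show ?case
  proof (cases "s < 2 * q")
    case True
    then show ?thesis using less by (simp add: le_mod_geq)
  next
    case False
    then have "\<alpha> (s - q) = \<alpha> (q + (s - q) mod q)" using less assms(2) by auto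
    moreover have "\<alpha> (s - q) = \<alpha> (s - q + q)"
      using assms(1) less False unfolding eventually_periodic_def by auto
    ultimately show ?thesis using False less by (simp add: le_mod_geq)
  qed
qed

lemma card_eventually_periodic:
  assumes "1 \<le> q"
  shows "card {\<alpha> \<in> patterns k. eventually_periodic k q \<alpha>} \<le> 2 ^ (2 * q - 1)"
proof -
  let ?P = "{\<alpha> \<in> patterns k. eventually_periodic k q \<alpha>}"
  let ?R = "{1..2 * q - 1} \<rightarrow>\<^sub>E (UNIV :: bit set)"
  let ?r = "\<lambda>\<alpha>. restrict \<alpha> {1..2 * q - 1}"
  have UNIV_bit: "(UNIV :: bit set) = {0, 1}" by auto
  have "inj_on ?r ?P"
  proof (rule inj_onI)
    fix \<alpha> \<beta> assume \<alpha>: "\<alpha> \<in> ?P" and \<beta>: "\<beta> \<in> ?P" and eq: "?r \<alpha> = ?r \<beta>"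
    have small: "\<alpha> s = \<beta> s" if "1 \<le> s" "s < 2 * q" for s
      using fun_cong[OF eq, of s] that by (auto simp: restrict_def split: if_splits)
    have "\<alpha> s = \<beta> s" for s
    proof (cases "s \<in> {1..k}")
      case False
      then show ?thesis using \<alpha> \<beta> by (auto simp: patterns_def PiE_def extensional_def)
    next
      case True
      show ?thesis
      proof (cases "s < q")
        case False
        \<comment> \<open>The representative lies between \<open>q\<close> and
          \<open>2 * q - 1\<close>, inside the window of restriction.\<close>
        have "\<alpha> (q + s mod q) = \<beta> (q + s mod q)" using assms by (intro small) auto
        then show ?thesis
          using eventually_periodic_mod[of k q \<alpha> s] eventually_periodic_mod[of k q \<beta> s] \<alpha> \<beta> True False assms by auto
      qed (use True small in auto)
    qed
    then show "\<alpha> = \<beta>" by blast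
  qed
  moreover have "?r ` ?P \<subseteq> ?R" by auto
  moreover have "finite ?R" unfolding UNIV_bit by (intro finite_PiE) auto
  ultimately have "card ?P \<le> card ?R" by (intro card_inj_on_le)
  also have "\<dots> = 2 ^ (2 * q - 1)" by (simp add: card_PiE UNIV_bit flip: numeral_2_eq_2)
  finally show ?thesis .
qed

section \<open>Lower bound for eventually periodic patterns\<close>

text \<open>The pattern splits as \<open>\<beta> + \<gamma>\<close>, where \<open>\<beta>\<close>
  continues the tail periodically down to 0 and \<open>\<gamma>\<close> corrects the values below
  \<open>q\<close>. Each part costs at most q m^(q-1) points, and the doubled singletons cost 2m
  \<le> 2 m^(q-1), as q \<ge> 2.\<close>

lemma max_size_periodic_ge:
  fixes q :: nat
  assumes q: "q = 2 ^ l" and l: "1 \<le> l" and per: "eventually_periodic k q \<alpha>"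
    and m: "1 \<le> m" "(2 * q + 2) * m ^ (q - 1) \<le> n"
  shows "m \<le> max_size k \<alpha> n"
proof -
  have q2: "2 \<le> q" using l self_le_power[of "2::nat" l] by (simp add: q)
  define \<beta> where "\<beta> s = \<alpha> (q + s mod q)" for s
  define \<gamma> where "\<gamma> s = (if s < q then \<alpha> s + \<beta> s else 0)" for s
  obtain Ts where Ts: "realizes m Ts \<beta>" "length Ts \<le> (\<Sum>j<q. m choose j)"
    using realizes_periodic[of \<beta> l m] by (auto simp: \<beta>_def q)
  obtain Us where Us: "realizes m Us \<gamma>" "length Us \<le> (\<Sum>j<q. m choose j)"
    using realizes_bounded_support[of q \<gamma> m] by (auto simp: \<gamma>_def)
  show ?thesis
  proof (rule realizes_le_max_size[OF realizes_append[OF Ts(1) Us(1)]])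
    have "m \<le> m ^ (q - 1)" using m q2 by (intro self_le_power) auto
    moreover have "(\<Sum>j<q. m choose j) \<le> q * m ^ (q - 1)" using m q2 by (intro sum_choose_le) auto
    ultimately show "length (Ts @ Us) + 2 * m \<le> n" using Ts Us m by (simp add: algebra_simps)
    fix s assume "1 \<le> s" "s \<le> k"
    then show "\<beta> s + \<gamma> s = \<alpha> s"
      using eventually_periodic_mod[OF per, of s] q2
      by (cases "s < q") (auto simp: \<gamma>_def \<beta>_def add.left_commute)
  qed
qed

lemma max_size_periodic_powr_ge:
  fixes q :: nat
  assumes q: "q = 2 ^ l" and l: "1 \<le> l" and per: "eventually_periodic k q \<alpha>" and n: "1 \<le> n"
  shows "real n powr (1 / (q - 1)) \<le> 2 * real (2 * q + 2) powr (1 / (q - 1)) * real (max_size k \<alpha> n)"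
proof -
  have q2: "2 \<le> q" using l self_le_power[of "2::nat" l] by (simp add: q)
  define K where "K = real (2 * q + 2)"
  define y where "y = (real n / K) powr (1 / (q - 1))"
  have K: "0 < K" by (simp add: K_def)
  have y0: "0 \<le> y" by (simp add: y_def)
  have yq: "y ^ (q - 1) = real n / K" using n q2 K by (simp add: y_def powr_power)
  define m where "m = nat \<lfloor>y\<rfloor>"
  have my: "real m \<le> y" "y \<le> real m + 1" using y0 by (simp_all add: m_def)
  have "m \<le> max_size k \<alpha> n"
  proof (cases "m = 0")
    case False
    show ?thesis
    proof (rule max_size_periodic_ge[OF q l per])
      have "real m ^ (q - 1) \<le> real n / K" using my by (metis yq power_mono of_nat_0_le_iff)
      then have "real (2 * q + 2) * real m ^ (q - 1) \<le> real n" using K by (simp add: K_def field_simps)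
      then show "(2 * q + 2) * m ^ (q - 1) \<le> n" by (metis of_nat_le_iff of_nat_mult of_nat_power)
    qed (use False in simp)
  qed simp
  \<comment> \<open>Rounding down loses less than 1, which is absorbed by the factor 2 because the
    maximum size is at least 1.\<close>
  then have "y \<le> 2 * real (max_size k \<alpha> n)" using my max_size_pos[OF n, of k \<alpha>] by linarith
  moreover have "real n powr (1 / (q - 1)) = K powr (1 / (q - 1)) * y"
    using K by (simp add: y_def powr_divide)
  ultimately show ?thesis using K by (simp add: K_def mult.left_commute)
qed

section \<open>Comparison of the two growth rates\<close>

lemma powr_not_bounded:
  assumes "0 < (e::real)"
  shows "\<exists>n\<ge>1. C < real n powr e"
proof -
  define x where "x = (\<bar>C\<bar> + 1) powr (1 / e)"
  define n where "n = nat \<lceil>x\<rceil>"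
  have x: "0 < x" by (simp add: x_def add_nonneg_pos less_imp_neq[symmetric])
  have n: "x \<le> real n" by (simp add: n_def real_nat_ceiling_ge)
  have "C < \<bar>C\<bar> + 1" by simp
  also have "\<dots> = x powr e" using assms by (simp add: x_def powr_powr)
  also have "\<dots> \<le> real n powr e" using n x assms by (intro powr_mono2) auto
  finally show ?thesis using n x by (intro exI[of _ n]) auto
qed

theorem theoremI2:
  fixes l k :: nat
  assumes "l \<ge> 1" and "k \<ge> 2"
  shows "card {\<alpha> \<in> patterns k.
           (\<lambda>n. real (max_size k \<alpha> n)) \<in> \<Omega>[principal {1..}](\<lambda>n. real n powr (1 / (2 ^ l - 1)))}
           \<le> 2 ^ (2 ^ (l + 1) - 1)
       \<and> (\<forall>\<alpha> \<in> patterns k.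
           (\<lambda>n. real (max_size k \<alpha> n)) \<notin> \<Omega>[principal {1..}](\<lambda>n. real n powr (1 / (2 ^ l - 1)))
           \<longrightarrow> (\<lambda>n. real (max_size k \<alpha> n)) \<in> O[principal {1..}](\<lambda>n. real n powr (1 / 2 ^ l)))"
proof -
  define q :: nat where "q = 2 ^ l"
  have q2: "2 \<le> q" using assms(1) self_le_power[of "2::nat" l] by (simp add: q_def)
  have exps: "(1 / (2 ^ l - 1) :: real) = 1 / real (q - 1)" "(1 / 2 ^ l :: real) = 1 / real q"
    using q2 by (simp_all add: q_def of_nat_diff)
  let ?f = "\<lambda>\<alpha> n. real (max_size k \<alpha> n)"
  have upper: "\<exists>c>0. \<forall>n\<ge>1. ?f \<alpha> n \<le> c * real n powr (1 / real q)"
    if "\<not> eventually_periodic k q \<alpha>" for \<alpha>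
  proof -
    obtain s where s: "q \<le> s" "s + q \<le> k" "\<alpha> s \<noteq> \<alpha> (s + q)"
      using \<open>\<not> eventually_periodic k q \<alpha>\<close> by (auto simp: eventually_periodic_def)
    have "0 < k + 2 * q ^ (q + 1) + 2 * q" using assms by simp
    then have "0 < real (k + 2 * q ^ (q + 1) + 2 * q)" by (simp only: of_nat_0_less_iff)
    with max_size_aperiodic_le[OF q_def s] show ?thesis by blast
  qed
  \<comment> \<open>Counting all patterns with the lower bound also needs the converse: a pattern
    that is not eventually periodic has order at most n^(1/q), which is incompatible with the larger
    order n^(1/(q-1)).\<close>
  have omega: "?f \<alpha> \<in> \<Omega>[principal {1..}](\<lambda>n. real n powr (1 / (2 ^ l - 1)))
      \<longleftrightarrow> eventually_periodic k q \<alpha>" for \<alpha>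
  proof -
    have "?f \<alpha> \<in> \<Omega>[principal {1..}](\<lambda>n. real n powr (1 / (2 ^ l - 1)))
      \<longleftrightarrow> (\<exists>c>0. \<forall>n\<ge>1. real n powr (1 / real (q - 1)) \<le> c * ?f \<alpha> n)"
      unfolding bigomega_all_positive_iff exps by (rule bigo_all_positive_iff) auto
    also have "\<dots> \<longleftrightarrow> eventually_periodic k q \<alpha>"
    proof
      assume per: "eventually_periodic k q \<alpha>"
      have "0 < 2 * real (2 * q + 2) powr (1 / (q - 1))" by (simp add: add_nonneg_pos less_imp_neq[symmetric])
      with max_size_periodic_powr_ge[OF q_def assms(1) per]
      show "\<exists>c>0. \<forall>n\<ge>1. real n powr (1 / real (q - 1)) \<le> c * ?f \<alpha> n" by blast
    next
      assume "\<exists>c>0. \<forall>n\<ge>1. real n powr (1 / real (q - 1)) \<le> c * ?f \<alpha> n"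
      then obtain c where c: "0 < c" "\<And>n. 1 \<le> n \<Longrightarrow> real n powr (1 / real (q - 1)) \<le> c * ?f \<alpha> n"
        by blast
      show "eventually_periodic k q \<alpha>"
      proof (rule ccontr)
        assume "\<not> eventually_periodic k q \<alpha>"
        then obtain d where d: "\<And>n. 1 \<le> n \<Longrightarrow> ?f \<alpha> n \<le> d * real n powr (1 / real q)"
          using upper by blast
        \<comment> \<open>The two bounds together would keep n raised to this positive gap below the
          constant \<open>c * d\<close>.\<close>
        have "0 < 1 / real (q - 1) - 1 / real q"
          using q2 by (simp add: field_simps of_nat_diff)
        then obtain n where n: "1 \<le> n" "c * d < real n powr (1 / real (q - 1) - 1 / real q)"
          using powr_not_bounded by blast
        have "c * d * real n powr (1 / real q) < real n powr (1 / real (q - 1) - 1 / real q) * real n powr (1 / real q)"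
          using n by (intro mult_strict_right_mono) auto
        also have "\<dots> = real n powr (1 / real (q - 1))" by (simp flip: powr_add)
        also have "\<dots> \<le> c * (d * real n powr (1 / real q))"
          using c(2)[OF n(1)] mult_left_mono[OF d[OF n(1)], of c] c(1) by linarith
        finally show False by (simp add: mult.assoc)
      qed
    qed
    finally show ?thesis .
  qed
  have "card {\<alpha> \<in> patterns k. eventually_periodic k q \<alpha>} \<le> 2 ^ (2 ^ (l + 1) - 1)"
    using card_eventually_periodic[of q k] q2 by (simp add: q_def)
  moreover have "?f \<alpha> \<in> O[principal {1..}](\<lambda>n. real n powr (1 / 2 ^ l))"
    if "\<not> eventually_periodic k q \<alpha>" for \<alpha>
    unfolding exps using upper[OF that] by (subst bigo_all_positive_iff) auto
  ultimately show ?thesis unfolding omega by blast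
qed

end
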